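(* Consider a linear, time-independent underactuated system on $\mathbb{R}^n$ with coordinates $q=(q^1,\dots,q^n)$: the mass matrix $g_{ij}$ and the $g$-orthogonal projection $P^i_j$ are constant, the potential energy is $V(q)=V_{ij}q^iq^j+v_kq^k$ with constants $V_{ij}=V_{ji}$ and $v_k$, and the dissipation is $C_i=C_{ij}\dot q^j$ with constants $C_{ij}$. Then the family of matching control laws of the system contains all linear state feedback laws. That is, for all constants $a_{ki}, b_{ki}$ such that the control law $$u_k=v_k+a_{ki}q^i+b_{ki}\dot q^i,\qquad k=1,\dots,n,$$ satisfies $P^r_k g^{k\ell}u_\ell=0$ for all $r$ and all $(q,\dot q)\in\mathbb{R}^n\times\mathbb{R}^n$, there exist a smooth symmetric nondegenerate matrix-valued function $\widehat g_{ij}(q)$, a smooth function $\widehat V(q)$, and smooth functions $\widehat C_i(q,\dot q)$, odd in $\dot q$, which satisfy the matching conditions $$P^r_k\left(\Gamma^k_{ij}-\widehat\Gamma^k_{ij}\right)=0,\qquad P^r_k\left(g^{ki}C_i-\widehat g^{ki}\widehat C_i\right)=0,\qquad P^r_k\left(g^{ki}\frac{\partial V}{\partial q^i}-\widehat g^{ki}\frac{\partial\widehat V}{\partial q^i}\right)=0$$ and for which $$u_r=g_{rk}\left(\Gamma^k_{ij}-\widehat\Gamma^k_{ij}\right)\dot q^i\dot q^j+g_{rk}\left(g^{ki}C_i-\widehat g^{ki}\widehat C_i\right)+g_{rk}\left(g^{ki}\frac{\partial V}{\partial q^i}-\widehat g^{ki}\frac{\partial\widehat V}{\partial q^i}\right),\qquad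 r=1,\dots,n.$$
   Context: Summation over repeated indices is understood. An underactuated system is a system of the form $$g_{rj}\ddot q^j+[jk,r]\,\dot q^j\dot q^k+C_r+\frac{\partial V}{\partial q^r}=u_r,\qquad r=1,\dots,n,$$ where $g_{ij}$ is the mass matrix (symmetric, positive definite) with inverse $g^{ij}$, $C_r(q,\dot q)$ is the dissipation (odd in the velocities $\dot q$), $V(q)$ is the potential energy, $u_r$ is the applied actuation, and $$[jk,i]=\tfrac12\left(\frac{\partial g_{ij}}{\partial q^k}+\frac{\partial g_{ki}}{\partial q^j}-\frac{\partial g_{jk}}{\partial q^i}\right),\qquad \Gamma^k_{ij}=g^{k\ell}[ij,\ell]$$ are the Christoffel symbols of the first and second kind. The fact that some degrees of freedom are unactuated is encoded by the requirement $P^i_jg^{jk}u_k=0$, where $P$ is a $g$-orthogonal projection, i.e. $P^i_jP^j_k=P^i_k$ and $P^k_ig_{kj}=g_{ik}P^k_j$. Given a symmetric nondegenerate (not necessarily positive definite) matrix-valued function $\widehat g_{ij}(q)$, $\widehat g^{ij}$ denotes its inverse and $\widehat\Gamma^k_{ij}$ denotes the Christoffel symbols of the second kind formed from $\widehat g$ by the same formulas. A matching control law is a control law $u$ for which the closed loop system takes the form $\widehat g_{rj}\ddot q^j+\widehat{[jk,r]}\,\dot q^j\dot q^k+\widehat C_r+\partial\widehat V/\partial q^r=0$ for some $\widehat g,\widehat C,\widehat V$, subject to the restriction $P^i_jg^{jk}u_k=0$; equivalently, $\widehat g,\widehat V,\widehat C$ satisfy the matching conditions displayed in the claim and $u$ is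 given by the displayed formula. Coordinates are chosen so that the desired equilibrium is the origin; accordingly, the constant term of a linear state feedback law is $v_k=\partial V/\partial q^k(0)$. *)

theory Defs
  imports "HOL-Analysis.Analysis"
begin

text \<open>
  A matrix with components \<open>M\<^sup>i\<^sub>j\<close> or \<open>M\<^sub>i\<^sub>j\<close> is \<open>M :: real^'n^'n\<close> with entries \<open>M $ i $ j\<close>;
  configurations \<open>q\<close> and velocities \<open>qd\<close> are elements of \<open>real^'n\<close>.
\<close>

section \<open>Smooth functions\<close>

fun Ck :: "nat \<Rightarrow> ('a::euclidean_space \<Rightarrow> real) \<Rightarrow> bool" where
  "Ck 0 f \<longleftrightarrow> continuous_on UNIV f"
| "Ck (Suc k) f \<longleftrightarrow>
     (\<forall>x. f differentiable at x) \<and>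
     (\<forall>b\<in>Basis. Ck k (\<lambda>x. frechet_derivative f (at x) b))"

definition smooth :: "('a::euclidean_space \<Rightarrow> real) \<Rightarrow> bool" where
  "smooth f \<longleftrightarrow> (\<forall>k. Ck k f)"

text \<open>Only meaningful where \<open>f\<close> is differentiable.\<close>
definition partial_deriv :: "'n::finite \<Rightarrow> (real^'n \<Rightarrow> real) \<Rightarrow> real^'n \<Rightarrow> real" where
  "partial_deriv k f q = frechet_derivative f (at q) (axis k 1)"

definition grad :: "(real^'n \<Rightarrow> real) \<Rightarrow> real^'n \<Rightarrow> real^'n::finite" where
  "grad f q = (\<chi> i. partial_deriv i f q)"

section \<open>Matrices and metrics\<close>

definition symmetric_mat :: "real^'n^'n::finite \<Rightarrow> bool" where
  "symmetric_mat A \<longleftrightarrow> transpose A = A"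

definition pos_def :: "real^'n^'n::finite \<Rightarrow> bool" where
  "pos_def A \<longleftrightarrow> (\<forall>x. x \<noteq> 0 \<longrightarrow> x \<bullet> (A *v x) > 0)"

text \<open>\<open>P\<^sup>i\<^sub>j P\<^sup>j\<^sub>k = P\<^sup>i\<^sub>k\<close> and \<open>P\<^sup>k\<^sub>i g\<^sub>k\<^sub>j = g\<^sub>i\<^sub>k P\<^sup>k\<^sub>j\<close>.\<close>
definition orthogonal_projection :: "real^'n^'n \<Rightarrow> real^'n^'n::finite \<Rightarrow> bool" where
  "orthogonal_projection g P \<longleftrightarrow> P ** P = P \<and> transpose P ** g = g ** P"

text \<open>\<open>christoffel1 g q j k i\<close> is \<open>[jk,i]\<close> at \<open>q\<close>.\<close>
definition christoffel1 ::
    "(real^'n \<Rightarrow> real^'n^'n) \<Rightarrow> real^'n \<Rightarrow> 'n::finite \<Rightarrow> 'n \<Rightarrow> 'n \<Rightarrow> real" where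
  "christoffel1 g q j k i =
     (partial_deriv k (\<lambda>x. g x $ i $ j) q + partial_deriv j (\<lambda>x. g x $ k $ i) q
        - partial_deriv i (\<lambda>x. g x $ j $ k) q) / 2"

text \<open>\<open>christoffel2 g q k i j\<close> is \<open>\<Gamma>\<^sup>k\<^sub>i\<^sub>j\<close> at \<open>q\<close>.\<close>
definition christoffel2 ::
    "(real^'n \<Rightarrow> real^'n^'n) \<Rightarrow> real^'n \<Rightarrow> 'n::finite \<Rightarrow> 'n \<Rightarrow> 'n \<Rightarrow> real" where
  "christoffel2 g q k i j = (\<Sum>l\<in>UNIV. matrix_inv (g q) $ k $ l * christoffel1 g q i j l)"

section \<open>Matching\<close>

text \<open>
  A system is given by a mass matrix \<open>g\<close>, dissipation \<open>C\<close> (a function of position and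
  velocity), potential \<open>V\<close> and projection \<open>P\<close>.  The primed data are the hatted
  (closed loop) ones.
\<close>

definition respects_underactuation ::
    "(real^'n \<Rightarrow> real^'n^'n) \<Rightarrow> (real^'n \<Rightarrow> real^'n^'n)
      \<Rightarrow> (real^'n \<Rightarrow> real^'n \<Rightarrow> real^'n::finite) \<Rightarrow> bool" where
  "respects_underactuation g P u \<longleftrightarrow> (\<forall>q qd. P q *v (matrix_inv (g q) *v u q qd) = 0)"

definition admissible_closed_loop ::
    "(real^'n \<Rightarrow> real^'n^'n) \<Rightarrow> (real^'n \<Rightarrow> real^'n \<Rightarrow> real^'n) \<Rightarrow> (real^'n::finite \<Rightarrow> real)
      \<Rightarrow> bool" where
  "admissible_closed_loop g' C' V' \<longleftrightarrow>
     (\<forall>i j. smooth (\<lambda>q. g' q $ i $ j)) \<and>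
     (\<forall>q. symmetric_mat (g' q) \<and> invertible (g' q)) \<and>
     (\<forall>i. smooth (\<lambda>(q, qd). C' q qd $ i)) \<and>
     (\<forall>q qd. C' q (- qd) = - C' q qd) \<and>
     smooth V'"

definition matching_conditions ::
    "(real^'n \<Rightarrow> real^'n^'n) \<Rightarrow> (real^'n \<Rightarrow> real^'n^'n)
      \<Rightarrow> (real^'n \<Rightarrow> real^'n \<Rightarrow> real^'n) \<Rightarrow> (real^'n::finite \<Rightarrow> real)
      \<Rightarrow> (real^'n \<Rightarrow> real^'n^'n) \<Rightarrow> (real^'n \<Rightarrow> real^'n \<Rightarrow> real^'n) \<Rightarrow> (real^'n \<Rightarrow> real)
      \<Rightarrow> bool" where
  "matching_conditions g P C V g' C' V' \<longleftrightarrow>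
     (\<forall>q r i j. (\<Sum>k\<in>UNIV. P q $ r $ k * (christoffel2 g q k i j - christoffel2 g' q k i j)) = 0) \<and>
     (\<forall>q qd. P q *v (matrix_inv (g q) *v C q qd - matrix_inv (g' q) *v C' q qd) = 0) \<and>
     (\<forall>q. P q *v (matrix_inv (g q) *v grad V q - matrix_inv (g' q) *v grad V' q) = 0)"

definition matching_control ::
    "(real^'n \<Rightarrow> real^'n^'n)
      \<Rightarrow> (real^'n \<Rightarrow> real^'n \<Rightarrow> real^'n) \<Rightarrow> (real^'n::finite \<Rightarrow> real)
      \<Rightarrow> (real^'n \<Rightarrow> real^'n^'n) \<Rightarrow> (real^'n \<Rightarrow> real^'n \<Rightarrow> real^'n) \<Rightarrow> (real^'n \<Rightarrow> real)
      \<Rightarrow> real^'n \<Rightarrow> real^'n \<Rightarrow> real^'n" where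
  "matching_control g C V g' C' V' q qd =
     g q *v (\<chi> k. \<Sum>i\<in>UNIV. \<Sum>j\<in>UNIV.
                (christoffel2 g q k i j - christoffel2 g' q k i j) * qd $ i * qd $ j) +
     g q *v (matrix_inv (g q) *v C q qd - matrix_inv (g' q) *v C' q qd) +
     g q *v (matrix_inv (g q) *v grad V q - matrix_inv (g' q) *v grad V' q)"

end

theory Submission
  imports Defs
begin

text \<open>
  A constant closed loop metric \<open>S\<close> suffices.  Then all Christoffel symbols vanish, and the control
  law has only a dissipation part and a potential part.  Because \<open>S\<close> is invertible, the dissipation
  part can be given any value that is linear in the velocity: the term \<open>b qd\<close> is produced by
  \<open>C' = S g\<^sup>-\<^sup>1 (Cmat - b) qd\<close>.  The potential part must produce \<open>v + a q\<close>, which forces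
  \<open>grad V' = S A q\<close> with \<open>A = g\<^sup>-\<^sup>1 (2 Vmat - a)\<close>.  This is a gradient field exactly when \<open>S A\<close> is
  symmetric, and then \<open>V' = q \<bullet> (S A q) / 2\<close>.  The matching conditions hold because the condition
  \<open>P g\<^sup>-\<^sup>1 u = 0\<close> for all \<open>(q, qd)\<close> splits into one condition on \<open>v + a q\<close> and one on \<open>b qd\<close>.

  What remains is a theorem of Frobenius, \<open>symmetric_symmetrizer\<close>: for every real square matrix \<open>A\<close>
  there is an invertible symmetric \<open>S\<close> such that \<open>S A\<close> is symmetric.  In other words, every
  endomorphism \<open>T\<close> is self-adjoint for some nondegenerate symmetric bilinear form.  The proof is by
  induction on the dimension of a \<open>T\<close>-invariant subspace \<open>U\<close>, and splits off a cyclic summand.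
  Choose \<open>v \<in> U\<close> and a functional \<open>f\<close> with \<open>f (T\<^sup>i v) = 0\<close> for \<open>i < m\<close> and \<open>f (T\<^sup>m v) \<noteq> 0\<close>, where \<open>m\<close> is
  as large as possible (\<open>detects_bounded\<close> bounds \<open>m\<close>).  By maximality both
  \<open>W = span {v, T v, \<dots>, T\<^sup>m v}\<close> and \<open>W' = {x \<in> U. f (T\<^sup>i x) = 0 for all i \<le> m}\<close> are invariant.  The matrix
  \<open>f (T\<^sup>i\<^sup>+\<^sup>j v)\<close>, \<open>i, j \<le> m\<close>, has zeros on one side of its antidiagonal and a nonzero constant on it, so
  \<open>U = W \<oplus> W'\<close>, and the Hankel form \<open>(T\<^sup>i v, T\<^sup>j v) \<mapsto> f (T\<^sup>i\<^sup>+\<^sup>j v)\<close> is nondegenerate on \<open>W\<close>.  The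
  induction hypothesis gives a form on \<open>W'\<close>, and the two are added by
  \<open>selfadjoint_form_direct_sum\<close>.
\<close>

section \<open>Nondegenerate forms making an endomorphism self-adjoint\<close>

text \<open>
  The bilinear form \<open>(x, y) \<mapsto> S x \<bullet> y\<close>, restricted to \<open>U\<close>, is symmetric and nondegenerate, and \<open>T\<close> is
  self-adjoint for it.  The form is encoded by an operator \<open>S\<close> on the whole space, which need not
  preserve \<open>U\<close> and whose values on the orthogonal complement of \<open>U\<close> are irrelevant.
\<close>
definition selfadjoint_form ::
    "('a::euclidean_space \<Rightarrow> 'a) \<Rightarrow> 'a set \<Rightarrow> ('a \<Rightarrow> 'a) \<Rightarrow> bool" where
  "selfadjoint_form T U S \<longleftrightarrow> linear S \<and>
     (\<forall>x\<in>U. \<forall>y\<in>U. S x \<bullet> y = x \<bullet> S y) \<and>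
     (\<forall>x\<in>U. \<forall>y\<in>U. S (T x) \<bullet> y = S x \<bullet> T y) \<and>
     (\<forall>x\<in>U. (\<forall>y\<in>U. S x \<bullet> y = 0) \<longrightarrow> x = 0)"

lemma linear_funpow:
  fixes T :: "'a::real_vector \<Rightarrow> 'a"
  assumes "linear T"
  shows "linear (T ^^ k)"
proof (induction k)
  case 0
  then show ?case by (simp add: linear_id id_def[symmetric])
next
  case (Suc k)
  then show ?case using linear_compose[OF Suc assms] by (simp add: o_def)
qed

lemma projection_along:
  fixes W W' :: "'a::euclidean_space set"
  assumes "subspace W" "subspace W'" "W \<inter> W' = {0}"
  obtains p where "linear p" "\<And>x. x \<in> W \<Longrightarrow> p x = 0" "\<And>x. x \<in> W' \<Longrightarrow> p x = x"
proof -
  obtain B where B: "B \<subseteq> W" "independent B" "W \<subseteq> span B" "card B = dim W"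
    using basis_exists by blast
  obtain B' where B': "B' \<subseteq> W'" "independent B'" "W' \<subseteq> span B'" "card B' = dim W'"
    using basis_exists by blast
  have spB: "span B = W" and spB': "span B' = W'"
    using span_subspace[OF B(1,3) assms(1)] span_subspace[OF B'(1,3) assms(2)] .
  have disj: "B \<inter> B' = {}"
  proof (rule ccontr)
    assume "B \<inter> B' \<noteq> {}"
    then obtain x where x: "x \<in> B" "x \<in> B'" by blast
    then have "x \<in> W \<inter> W'" using B(1) B'(1) by blast
    then have "0 \<in> B" using x assms(3) by simp
    then show False using B(2) dependent_zero by auto
  qed
  have fin: "finite B" "finite B'"
    using B(2) B'(2) finiteI_independent by blast+
  have "{x + y |x y. x \<in> span B \<and> y \<in> span B'} = span (B \<union> B')"
    by (auto simp: span_Un)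
  then have "dim (span (B \<union> B')) = dim W + dim W'"
    using dim_sums_Int[OF assms(1,2)] assms(3) spB spB' by simp
  then have "dim (B \<union> B') = card (B \<union> B')"
    using B B' fin disj by (simp add: card_Un_disjoint)
  then have ind: "independent (B \<union> B')"
    using fin by (intro card_le_dim_spanning[OF order_refl span_superset]) auto
  obtain p where p: "linear p" "\<forall>x\<in>B \<union> B'. p x = (if x \<in> B then 0 else x)"
    using linear_independent_extend[OF ind, of "\<lambda>x. if x \<in> B then 0 else x"] by blast
  show ?thesis
  proof (rule that[OF p(1)])
    fix x assume "x \<in> W"
    then have "x \<in> span B" by (simp only: spB)
    then show "p x = 0"
      by (rule linear_eq_on[OF p(1) linear_zero]) (simp add: p(2))
  next
    fix x assume "x \<in> W'"
    then have "x \<in> span B'" by (simp only: spB')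
    then show "p x = x"
    proof (rule linear_eq_on[OF p(1) linear_ident])
      fix b assume "b \<in> B'"
      moreover from this have "b \<notin> B" using disj by blast
      ultimately show "p b = b" using p(2) by simp
    qed
  qed
qed

text \<open>
  The orthogonal direct sum of the two forms.  The projections are needed because \<open>W\<close> and \<open>W'\<close> are
  not assumed to be orthogonal for the inner product.
\<close>
lemma selfadjoint_form_direct_sum:
  fixes T :: "'a::euclidean_space \<Rightarrow> 'a"
  assumes T: "linear T"
    and W: "subspace W" "T ` W \<subseteq> W" "selfadjoint_form T W L"
    and W': "subspace W'" "T ` W' \<subseteq> W'" "selfadjoint_form T W' S"
    and Int: "W \<inter> W' = {0}"
    and U: "U = {x + y |x y. x \<in> W \<and> y \<in> W'}"
  shows "\<exists>R. selfadjoint_form T U R"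
proof -
  obtain p where p: "linear p" "\<And>x. x \<in> W \<Longrightarrow> p x = 0" "\<And>x. x \<in> W' \<Longrightarrow> p x = x"
    using projection_along[OF W(1) W'(1) Int] by blast
  have lin: "linear L" "linear S"
    using W(3) W'(3) by (auto simp: selfadjoint_form_def)
  define q where "q = (\<lambda>x. x - p x)"
  have q: "linear q"
    unfolding q_def using linear_compose_sub[OF linear_ident p(1)] .
  define R where "R = (\<lambda>x. adjoint q (L (q x)) + adjoint p (S (p x)))"
  have "linear (adjoint q \<circ> (L \<circ> q))" "linear (adjoint p \<circ> (S \<circ> p))"
    using p q lin by (auto intro!: linear_compose adjoint_linear)
  then have R: "linear R"
    unfolding R_def o_def by (rule linear_compose_add)
  have form: "R x \<bullet> y = L (q x) \<bullet> q y + S (p x) \<bullet> p y" for x y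
    unfolding R_def by (simp add: inner_add_left adjoint_clauses[OF p(1)] adjoint_clauses[OF q])
  have pq: "p (w + w') = w'" "q (w + w') = w" if "w \<in> W" "w' \<in> W'" for w w'
    using p that by (simp_all add: q_def linear_add)
  have dec: "R (w + w') \<bullet> (z + z') = L w \<bullet> z + S w' \<bullet> z'"
    if "w \<in> W" "w' \<in> W'" "z \<in> W" "z' \<in> W'" for w w' z z'
    by (simp add: form pq that)
  have Tadd: "T (x + y) = T x + T y" for x y using T by (simp add: linear_add)
  have sym: "R x \<bullet> y = x \<bullet> R y" if "x \<in> U" "y \<in> U" for x y
  proof -
    obtain w w' z z' where *: "x = w + w'" "y = z + z'" "w \<in> W" "w' \<in> W'" "z \<in> W" "z' \<in> W'"
      using \<open>x \<in> U\<close> \<open>y \<in> U\<close> U by blast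
    have "L w \<bullet> z = L z \<bullet> w" "S w' \<bullet> z' = S z' \<bullet> w'"
      using * W(3) W'(3) unfolding selfadjoint_form_def by (simp_all add: inner_commute)
    then have "R x \<bullet> y = R y \<bullet> x"
      unfolding *(1,2) by (simp only: dec *(3-6))
    then show ?thesis by (simp only: inner_commute)
  qed
  have self: "R (T x) \<bullet> y = R x \<bullet> T y" if "x \<in> U" "y \<in> U" for x y
  proof -
    obtain w w' z z' where *: "x = w + w'" "y = z + z'" "w \<in> W" "w' \<in> W'" "z \<in> W" "z' \<in> W'"
      using \<open>x \<in> U\<close> \<open>y \<in> U\<close> U by blast
    have "T w \<in> W" "T z \<in> W" "T w' \<in> W'" "T z' \<in> W'"
      using * W(2) W'(2) by auto
    moreover have "L (T w) \<bullet> z = L w \<bullet> T z" "S (T w') \<bullet> z' = S w' \<bullet> T z'"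
      using * W(3) W'(3) unfolding selfadjoint_form_def by blast+
    ultimately show ?thesis
      unfolding *(1,2) Tadd by (simp only: dec *(3-6))
  qed
  have nondeg: "x = 0" if x: "x \<in> U" and 0: "\<forall>y\<in>U. R x \<bullet> y = 0" for x
  proof -
    obtain w w' where *: "x = w + w'" "w \<in> W" "w' \<in> W'"
      using x U by blast
    have "L w \<bullet> z = 0" if "z \<in> W" for z
    proof -
      have "z + 0 \<in> U" using U that subspace_0[OF W'(1)] by blast
      then have "R x \<bullet> (z + 0) = 0" using 0 by blast
      then show ?thesis using dec[OF *(2,3) that subspace_0[OF W'(1)]] * by simp
    qed
    moreover have "S w' \<bullet> z = 0" if "z \<in> W'" for z
    proof -
      have "0 + z \<in> U" using U that subspace_0[OF W(1)] by blast
      then have "R x \<bullet> (0 + z) = 0" using 0 by blast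
      then show ?thesis using dec[OF *(2,3) subspace_0[OF W(1)] that] * by simp
    qed
    ultimately have "w = 0" "w' = 0"
      using W(3) W'(3) * unfolding selfadjoint_form_def by blast+
    then show ?thesis using * by simp
  qed
  show ?thesis
    unfolding selfadjoint_form_def using R sym self nondeg by (intro exI[of _ R] conjI ballI impI)
qed

section \<open>Functionals along an orbit\<close>

text \<open>
  The functional \<open>f\<close>, represented as a vector by the inner product, vanishes on \<open>T\<^sup>i v\<close> for \<open>i < m\<close> and
  is nonzero on \<open>T\<^sup>m v\<close>.
\<close>
definition detects :: "('a::euclidean_space \<Rightarrow> 'a) \<Rightarrow> nat \<Rightarrow> 'a \<Rightarrow> 'a \<Rightarrow> bool" where
  "detects T m f v \<longleftrightarrow> (\<forall>i<m. f \<bullet> (T ^^ i) v = 0) \<and> f \<bullet> (T ^^ m) v \<noteq> 0"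

abbreviation orbit_segment :: "('a \<Rightarrow> 'a) \<Rightarrow> 'a \<Rightarrow> nat \<Rightarrow> 'a set" where
  "orbit_segment T v k \<equiv> (\<lambda>i. (T ^^ i) v) ` {..<k}"

text \<open>
  A linear relation expressing \<open>T\<^sup>k v\<close> by lower powers would, after applying \<open>T\<^sup>m\<^sup>-\<^sup>k\<close>, express
  \<open>T\<^sup>m v\<close> by powers on which \<open>f\<close> vanishes.
\<close>
lemma detects_orbit_notin_span:
  fixes T :: "'a::euclidean_space \<Rightarrow> 'a"
  assumes T: "linear T" and det: "detects T m f v" and "k \<le> m"
  shows "(T ^^ k) v \<notin> span (orbit_segment T v k)"
proof
  assume "(T ^^ k) v \<in> span (orbit_segment T v k)"
  then have "(T ^^ (m - k)) ((T ^^ k) v) \<in> span ((T ^^ (m - k)) ` orbit_segment T v k)"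
    unfolding linear_span_image[OF linear_funpow[OF T]] by (rule imageI)
  moreover have "(T ^^ (m - k)) ((T ^^ k) v) = (T ^^ m) v"
    using \<open>k \<le> m\<close> funpow_add[of "m - k" k T] by simp
  moreover have "span ((T ^^ (m - k)) ` orbit_segment T v k) \<subseteq> {x. f \<bullet> x = 0}"
  proof -
    have "f \<bullet> (T ^^ (m - k)) ((T ^^ i) v) = 0" if "i < k" for i
    proof -
      have "(T ^^ (m - k)) ((T ^^ i) v) = (T ^^ (m - k + i)) v" by (simp add: funpow_add)
      then show ?thesis using det that \<open>k \<le> m\<close> by (simp add: detects_def)
    qed
    then have "(T ^^ (m - k)) ` orbit_segment T v k \<subseteq> {x. f \<bullet> x = 0}" by auto
    then show ?thesis
      by (rule span_minimal) (rule subspace_hyperplane)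
  qed
  ultimately have "f \<bullet> (T ^^ m) v = 0" by auto
  then show False using det by (simp add: detects_def)
qed

lemma detects_orbit_independent:
  fixes T :: "'a::euclidean_space \<Rightarrow> 'a"
  assumes T: "linear T" and det: "detects T m f v" and "k \<le> Suc m"
  shows "independent (orbit_segment T v k) \<and> inj_on (\<lambda>i. (T ^^ i) v) {..<k}"
  using \<open>k \<le> Suc m\<close>
proof (induction k)
  case 0
  then show ?case by (simp add: independent_empty)
next
  case (Suc k)
  then have IH: "independent (orbit_segment T v k)" "inj_on (\<lambda>i. (T ^^ i) v) {..<k}"
    by simp_all
  have new: "(T ^^ k) v \<notin> span (orbit_segment T v k)"
    using detects_orbit_notin_span[OF T det] Suc.prems by simp
  then have "(T ^^ k) v \<notin> orbit_segment T v k"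
    using span_base by metis
  moreover have "k \<notin> {..<k}" by simp
  ultimately have "inj_on (\<lambda>i. (T ^^ i) v) (insert k {..<k})"
    using IH(2) by simp
  moreover have "independent (insert ((T ^^ k) v) (orbit_segment T v k))"
    using independent_insertI[OF new IH(1)] .
  ultimately show ?case by (simp only: lessThan_Suc image_insert conj_absorb simp_thms)
qed

lemma detects_bounded:
  fixes T :: "'a::euclidean_space \<Rightarrow> 'a"
  assumes "linear T" and "detects T m f v"
  shows "m < DIM('a)"
proof -
  note ind = detects_orbit_independent[OF assms order_refl]
  have "card (orbit_segment T v (Suc m)) \<le> DIM('a)"
    by (rule independent_card_le) (use ind in blast)
  then show ?thesis using ind by (simp add: card_image)
qed

section \<open>Splitting off cyclic summands\<close>

lemma invariant_subspace_selfadjoint_form: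
  fixes T :: "'a::euclidean_space \<Rightarrow> 'a"
  assumes T: "linear T" and "subspace U" and "T ` U \<subseteq> U"
  shows "\<exists>S. selfadjoint_form T U S"
  using assms(2,3)
proof (induction "dim U" arbitrary: U rule: less_induct)
  case less
  note U = \<open>subspace U\<close> and TU = \<open>T ` U \<subseteq> U\<close>
  note lin = linear_funpow[OF T]
  have TUi: "(T ^^ i) x \<in> U" if "x \<in> U" for i x
    using that TU by (induction i) auto
  have pow: "(T ^^ i) ((T ^^ j) x) = (T ^^ (i + j)) x" for i j x
    by (simp add: funpow_add)
  show ?case
  proof (cases "U \<subseteq> {0}")
    case True
    then have "selfadjoint_form T U id"
      using U by (auto simp: selfadjoint_form_def linear_id linear_0[OF T])
    then show ?thesis by blast
  next
    case False
    then obtain x0 where x0: "x0 \<in> U" "x0 \<noteq> 0" by blast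
    let ?P = "\<lambda>m. \<exists>v\<in>U. \<exists>f. detects T m f v"
    have "?P 0" using x0 by (auto simp: detects_def intro!: bexI[of _ x0] exI[of _ x0])
    moreover have "\<forall>m. ?P m \<longrightarrow> m < DIM('a)" using detects_bounded[OF T] by blast
    ultimately have "\<exists>m. ?P m \<and> (\<forall>k. ?P k \<longrightarrow> k \<le> m)"
      by (rule ex_has_greatest_nat[of ?P 0 "\<lambda>k. k"])
    then obtain m where "?P m" and max: "\<forall>k. ?P k \<longrightarrow> k \<le> m" by blast
    then obtain v f where v: "v \<in> U" and det: "detects T m f v" by blast
    have nomore: "\<not> detects T (Suc m) h x" if "x \<in> U" for h x
      using max that by fastforce
    define B where "B = orbit_segment T v (Suc m)"
    define W where "W = span B"
    define W' where "W' = {x \<in> U. \<forall>i\<le>m. f \<bullet> (T ^^ i) x = 0}"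
    have indB: "independent B" and injB: "inj_on (\<lambda>i. (T ^^ i) v) {..<Suc m}"
      using detects_orbit_independent[OF T det order_refl] by (auto simp: B_def)
    have BW: "(T ^^ i) v \<in> W" if "i \<le> m" for i
      unfolding W_def B_def using that by (intro span_base) auto
    have W: "subspace W" by (simp add: W_def)
    have WU: "W \<subseteq> U"
      unfolding W_def B_def using U TUi v by (intro span_minimal) auto
    text \<open>If \<open>T\<^sup>m\<^sup>+\<^sup>1 v\<close> were outside \<open>W\<close>, its component orthogonal to \<open>W\<close>, as a functional, would
      vanish on \<open>T\<^sup>i v\<close> for \<open>i \<le> m\<close> but not on \<open>T\<^sup>m\<^sup>+\<^sup>1 v\<close>.\<close>
    have top: "(T ^^ Suc m) v \<in> W"
    proof (rule ccontr)
      assume n: "(T ^^ Suc m) v \<notin> W"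
      obtain y z where yz: "y \<in> span W" "\<And>w. w \<in> span W \<Longrightarrow> orthogonal z w"
          "(T ^^ Suc m) v = y + z"
        using orthogonal_subspace_decomp_exists by blast
      have "span W = W" using W by (simp only: span_eq_iff)
      then have "y \<in> W" using yz(1) by blast
      then have "z \<noteq> 0" using yz(3) n by (metis add.right_neutral)
      moreover have "z \<bullet> y = 0" using yz by (simp add: orthogonal_def)
      ultimately have "z \<bullet> (T ^^ Suc m) v \<noteq> 0" using yz(3) by (simp add: inner_add_right)
      moreover have "z \<bullet> (T ^^ i) v = 0" if "i < Suc m" for i
        using yz(2) BW that by (simp add: orthogonal_def span_base)
      ultimately have "detects T (Suc m) z v" by (simp add: detects_def)
      then show False using nomore v by blast
    qed
    have TB: "T ` B \<subseteq> W"
    proof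
      fix x assume "x \<in> T ` B"
      then obtain i where i: "i \<le> m" "x = (T ^^ Suc i) v"
        unfolding B_def by (auto simp: less_Suc_eq_le)
      show "x \<in> W"
        using top BW[of "Suc i"] i by (cases "i = m") auto
    qed
    have TW: "T ` W \<subseteq> W"
      using span_minimal[OF TB W] linear_span_image[OF T] by (simp add: W_def)
    have W': "subspace W'"
      using U unfolding subspace_def W'_def
      by (auto simp: linear_0[OF lin] linear_add[OF lin] linear_scale[OF lin] inner_add_right)
    have TW': "T ` W' \<subseteq> W'"
    proof
      fix y assume "y \<in> T ` W'"
      then obtain x where x: "x \<in> W'" "y = T x" by blast
      have "x \<in> U" and 0: "f \<bullet> (T ^^ i) x = 0" if "i \<le> m" for i using x that by (auto simp: W'_def)
      \<comment> \<open>Otherwise \<open>f\<close> and \<open>x\<close> would contradict the maximality of \<open>m\<close>.\<close>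
      have "f \<bullet> (T ^^ Suc m) x = 0"
        using nomore[of x f] 0 \<open>x \<in> W'\<close> by (auto simp: detects_def W'_def less_Suc_eq_le simp del: funpow.simps)
      then have "f \<bullet> (T ^^ Suc i) x = 0" if "i \<le> m" for i
        using 0[of "Suc i"] that by (cases "i = m") auto
      then have "f \<bullet> (T ^^ i) (T x) = 0" if "i \<le> m" for i
        using that by (simp add: funpow_swap1)
      then show "y \<in> W'" using x TU by (auto simp: W'_def)
    qed
    have Int: "W \<inter> W' = {0}"
    proof -
      \<comment> \<open>Applying \<open>f \<circ> T\<^sup>m\<^sup>-\<^sup>k\<close> to \<open>w\<close> isolates its coefficient at \<open>T\<^sup>k v\<close>.\<close>
      have "w = 0" if "w \<in> span (orbit_segment T v k)" "w \<in> W'" "k \<le> Suc m" for w k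
        using that
      proof (induction k)
        case 0
        then show ?case by simp
      next
        case (Suc k)
        obtain c where c: "w - c *\<^sub>R (T ^^ k) v \<in> span (orbit_segment T v k)"
          using Suc.prems(1) by (auto simp: lessThan_Suc span_breakdown_eq)
        have "orbit_segment T v k \<subseteq> {x. f \<bullet> (T ^^ (m - k)) x = 0}"
          using det Suc.prems(3) by (auto simp: pow detects_def)
        moreover have "subspace {x. f \<bullet> (T ^^ (m - k)) x = 0}"
          by (auto simp: subspace_def linear_0[OF lin] linear_add[OF lin] linear_scale[OF lin] inner_add_right)
        ultimately have "f \<bullet> (T ^^ (m - k)) (w - c *\<^sub>R (T ^^ k) v) = 0"
          using span_minimal c by blast
        moreover have "f \<bullet> (T ^^ (m - k)) w = 0" using Suc.prems(2) by (auto simp: W'_def)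
        moreover have "(T ^^ (m - k)) ((T ^^ k) v) = (T ^^ m) v"
          using Suc.prems(3) by (simp add: pow)
        ultimately have "c * (f \<bullet> (T ^^ m) v) = 0"
          by (simp add: linear_diff[OF lin] linear_scale[OF lin] inner_diff_right)
        then have "c = 0" using det by (simp add: detects_def)
        then show ?case using Suc c by simp
      qed
      then show ?thesis
        using subspace_0[OF W] subspace_0[OF W'] unfolding W_def B_def by blast
    qed
    have split: "\<exists>w\<in>W. x - w \<in> W'" if "x \<in> U" for x
    proof -
      \<comment> \<open>Adding a multiple of \<open>T\<^sup>m\<^sup>-\<^sup>k v\<close> to \<open>w\<close> changes \<open>f (T\<^sup>k (x - w))\<close> but none of the values at lower powers.\<close>
      have "\<exists>w\<in>W. \<forall>i<k. f \<bullet> (T ^^ i) (x - w) = 0" if "k \<le> Suc m" for k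
        using that
      proof (induction k)
        case 0
        then show ?case using subspace_0[OF W] by auto
      next
        case (Suc k)
        then obtain w where w: "w \<in> W" "\<forall>i<k. f \<bullet> (T ^^ i) (x - w) = 0" by auto
        define c where "c = f \<bullet> (T ^^ k) (x - w) / (f \<bullet> (T ^^ m) v)"
        define w1 where "w1 = w + c *\<^sub>R (T ^^ (m - k)) v"
        have "w1 \<in> W" unfolding w1_def
          using W w(1) BW by (simp add: subspace_add subspace_scale)
        moreover have "f \<bullet> (T ^^ i) (x - w1) = 0" if "i < Suc k" for i
        proof -
          have e: "f \<bullet> (T ^^ i) (x - w1) = f \<bullet> (T ^^ i) (x - w) - c * (f \<bullet> (T ^^ (i + (m - k))) v)"
            by (simp add: w1_def linear_diff[OF lin] linear_add[OF lin] linear_scale[OF lin] pow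
                inner_diff_right inner_add_right)
          show ?thesis
          proof (cases "i = k")
            case True
            then show ?thesis
              using det Suc.prems unfolding e by (simp add: c_def detects_def)
          next
            case False
            then show ?thesis
              using det Suc.prems that w(2) unfolding e by (simp add: detects_def)
          qed
        qed
        ultimately show ?case by blast
      qed
      from this[of "Suc m"] obtain w where w: "w \<in> W" "\<forall>i<Suc m. f \<bullet> (T ^^ i) (x - w) = 0" by auto
      moreover have "x - w \<in> U" using U that WU w(1) by (auto intro: subspace_diff)
      ultimately show ?thesis by (auto simp: W'_def less_Suc_eq_le)
    qed
    have sum: "U = {x + y |x y. x \<in> W \<and> y \<in> W'}"
    proof (intro equalityI subsetI)
      fix x assume "x \<in> U"
      then obtain w where "w \<in> W" "x - w \<in> W'" using split by blast
      then show "x \<in> {x + y |x y. x \<in> W \<and> y \<in> W'}"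
        by (intro CollectI exI[of _ w] exI[of _ "x - w"]) auto
    next
      fix x assume "x \<in> {x + y |x y. x \<in> W \<and> y \<in> W'}"
      then show "x \<in> U" using WU U by (auto simp: W'_def intro: subspace_add)
    qed

    have "v \<notin> W'" using det by (auto simp: W'_def detects_def)
    then have "W' \<subset> U" using v by (auto simp: W'_def)
    then have "dim W' < dim U"
      using U W' dim_psubset by (metis span_eq_iff)
    then obtain S where S: "selfadjoint_form T W' S"
      using less.hyps W' TW' by blast

    text \<open>The Hankel form on \<open>W\<close> is represented by the operator that sends \<open>T\<^sup>i v\<close> to the functional
      \<open>f \<circ> T\<^sup>i\<close>, that is, to the vector \<open>(T\<^sup>*)\<^sup>i f\<close>; \<open>e\<close> recovers the exponent from \<open>T\<^sup>i v\<close>.\<close>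
    define e where "e = the_inv_into {..<Suc m} (\<lambda>i. (T ^^ i) v)"
    obtain L where L: "linear L" "\<forall>x\<in>B. L x = (adjoint T ^^ e x) f"
      using linear_independent_extend[OF indB, of "\<lambda>x. (adjoint T ^^ e x) f"] by blast
    have adjpow: "(adjoint T ^^ i) f \<bullet> y = f \<bullet> (T ^^ i) y" for i y
    proof (induction i arbitrary: y)
      case (Suc i)
      have "(adjoint T ^^ Suc i) f \<bullet> y = (adjoint T ^^ i) f \<bullet> T y"
        using adjoint_clauses[OF T] by simp
      then show ?case using Suc by (simp add: funpow_swap1)
    qed simp
    have LB: "L ((T ^^ i) v) \<bullet> y = f \<bullet> (T ^^ i) y" if "i \<le> m" for i y
    proof -
      have "(T ^^ i) v \<in> B" using that by (auto simp: B_def)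
      then show ?thesis
        using L(2) the_inv_into_f_f[OF injB, of i] that by (simp add: adjpow e_def)
    qed
    have LW: "L x \<bullet> (T ^^ j) v = f \<bullet> (T ^^ j) x" if "x \<in> W" for x j
    proof -
      let ?Z = "{x. L x \<bullet> (T ^^ j) v = f \<bullet> (T ^^ j) x}"
      have "B \<subseteq> ?Z" by (auto simp: B_def LB pow add.commute)
      moreover have "subspace ?Z"
        by (auto simp: subspace_def linear_0[OF lin] linear_add[OF lin] linear_scale[OF lin]
            linear_0[OF L(1)] linear_add[OF L(1)] linear_scale[OF L(1)] inner_add_right inner_add_left)
      ultimately show ?thesis using span_minimal that unfolding W_def by blast
    qed
    have "L x \<bullet> y = x \<bullet> L y" if "x \<in> W" "y \<in> W" for x y
    proof -
      let ?Z = "{y. L x \<bullet> y = x \<bullet> L y}"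
      have "B \<subseteq> ?Z" using LW[OF that(1)] by (auto simp: B_def LB inner_commute[of x])
      moreover have "subspace ?Z"
        by (auto simp: subspace_def
            linear_0[OF L(1)] linear_add[OF L(1)] linear_scale[OF L(1)] inner_add_right)
      ultimately show ?thesis using span_minimal that(2) unfolding W_def by blast
    qed
    moreover have "L (T x) \<bullet> y = L x \<bullet> T y" if "x \<in> W" "y \<in> W" for x y
    proof -
      let ?Z = "{y. L (T x) \<bullet> y = L x \<bullet> T y}"
      have "T x \<in> W" using TW that by blast
      then have "L (T x) \<bullet> (T ^^ j) v = L x \<bullet> T ((T ^^ j) v)" for j
        using LW[of "T x" j] LW[OF that(1), of "Suc j"] by (simp add: funpow_swap1)
      then have "B \<subseteq> ?Z" by (auto simp: B_def)
      moreover have "subspace ?Z"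
        by (auto simp: subspace_def
            linear_0[OF T] linear_add[OF T] linear_scale[OF T] inner_add_right)
      ultimately show ?thesis using span_minimal that(2) unfolding W_def by blast
    qed
    moreover have "x = 0" if "x \<in> W" "\<forall>y\<in>W. L x \<bullet> y = 0" for x
    proof -
      have "f \<bullet> (T ^^ j) x = 0" if "j \<le> m" for j
        using LW[OF \<open>x \<in> W\<close>, of j] \<open>\<forall>y\<in>W. L x \<bullet> y = 0\<close> BW[OF that] by simp
      then have "x \<in> W'" using that(1) WU by (auto simp: W'_def)
      then show ?thesis using that(1) Int by blast
    qed
    ultimately have "selfadjoint_form T W L"
      using L(1) unfolding selfadjoint_form_def by blast
    from selfadjoint_form_direct_sum[OF T W TW this W' TW' S Int sum]
    show ?thesis .
  qed
qed

text \<open>A theorem of Frobenius, over the reals.\<close>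
theorem symmetric_symmetrizer:
  fixes A :: "real^'n^'n::finite"
  obtains S :: "real^'n^'n" where "symmetric_mat S" "invertible S" "symmetric_mat (S ** A)"
proof -
  obtain R where R: "selfadjoint_form ((*v) A) UNIV R"
    using invariant_subspace_selfadjoint_form[of "(*v) A" UNIV] by auto
  define S where "S = matrix R"
  have lin: "linear R" using R by (simp add: selfadjoint_form_def)
  have Sv: "S *v x = R x" for x
    unfolding S_def using matrix_works lin by (metis matrix_vector_mul)
  have sym: "(S *v x) \<bullet> y = x \<bullet> (S *v y)"
    and self: "(S *v (A *v x)) \<bullet> y = (S *v x) \<bullet> (A *v y)"
    and nondeg: "S *v x = 0 \<Longrightarrow> x = 0" for x y
    unfolding Sv using R unfolding selfadjoint_form_def by auto
  have symI: "symmetric_mat M" if "\<And>x y. (M *v x) \<bullet> y = x \<bullet> (M *v y)" for M :: "real^'n^'n"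
  proof -
    have "M $ i $ j = M $ j $ i" for i j
      using that[of "axis j 1" "axis i 1"]
      by (simp add: matrix_vector_mul_component inner_axis inner_axis' inner_commute
          flip: matrix_vector_mult_basis column_def)
    then show ?thesis by (simp add: symmetric_mat_def transpose_def vec_eq_iff)
  qed
  have "symmetric_mat S" using symI sym by blast
  moreover have "symmetric_mat (S ** A)"
    by (rule symI) (metis matrix_vector_mul_assoc self sym)
  moreover have "invertible S"
  proof -
    show ?thesis
      using nondeg by (metis invertible_left_inverse matrix_left_invertible_ker)
  qed
  ultimately show ?thesis using that by blast
qed

section \<open>Smoothness of polynomials of degree at most two\<close>

lemma Ck_const: "Ck k (\<lambda>x. c)"
  by (induction k arbitrary: c) simp_all

lemma Ck_linear:
  fixes f :: "'a::euclidean_space \<Rightarrow> real"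
  assumes "linear f"
  shows "Ck k f"
proof -
  have D: "(f has_derivative f) (at x)" for x
    using assms linear_imp_has_derivative by blast
  have F: "frechet_derivative f (at x) = f" for x
    using frechet_derivative_at[OF D] by (rule sym)
  have "continuous_on UNIV f"
    using has_derivative_continuous[OF D] by (intro continuous_at_imp_continuous_on) blast
  then show ?thesis
    using D by (cases k) (auto simp: F Ck_const differentiable_def)
qed

lemma smooth_const: "smooth (\<lambda>x. c)"
  by (simp add: smooth_def Ck_const)

lemma smooth_linear:
  fixes f :: "'a::euclidean_space \<Rightarrow> real"
  shows "linear f \<Longrightarrow> smooth f"
  by (simp add: smooth_def Ck_linear)

lemma has_derivative_quadratic_form:
  fixes N :: "real^'n^'n::finite"
  assumes "symmetric_mat N"
  shows "((\<lambda>q. q \<bullet> (N *v q)) has_derivative (\<lambda>h. 2 * (h \<bullet> (N *v q)))) (at q)"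
proof -
  have "q \<bullet> (N *v h) = h \<bullet> (N *v q)" for h
    using assms by (metis dot_lmul_matrix inner_commute symmetric_mat_def transpose_matrix_vector)
  moreover have "((*v) N has_derivative (*v) N) (at q)"
    by (rule linear_imp_has_derivative) (rule matrix_vector_mul_linear)
  note has_derivative_inner[OF has_derivative_ident this]
  ultimately show ?thesis by simp
qed

lemma smooth_quadratic_form:
  fixes N :: "real^'n^'n::finite"
  assumes "symmetric_mat N"
  shows "smooth (\<lambda>q. (q \<bullet> (N *v q)) / 2)"
proof -
  let ?f = "\<lambda>q. (q \<bullet> (N *v q)) / 2"
  have D: "(?f has_derivative (\<lambda>h. h \<bullet> (N *v q))) (at q)" for q
    using has_derivative_divide[OF has_derivative_quadratic_form[OF assms] has_derivative_const, of 2 q]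
    by simp
  have F: "frechet_derivative ?f (at q) = (\<lambda>h. h \<bullet> (N *v q))" for q
    using frechet_derivative_at[OF D] by (rule sym)
  have "linear (\<lambda>q. b \<bullet> (N *v q))" for b
    by (rule linearI) (simp_all add: matrix_vector_right_distrib inner_add_right matrix_vector_mult_scaleR)
  moreover have "continuous_on UNIV ?f"
    using has_derivative_continuous[OF D] by (intro continuous_at_imp_continuous_on) blast
  moreover have "\<forall>q. ?f differentiable at q"
    using D differentiable_def by blast
  ultimately have "Ck k ?f" for k
    by (cases k) (simp_all add: Ck_linear F)
  then show ?thesis by (simp add: smooth_def)
qed

lemma gradI:
  assumes "(f has_derivative (\<lambda>h. h \<bullet> w)) (at q)"
  shows "grad f q = w"
proof -
  have "frechet_derivative f (at q) = (\<lambda>h. h \<bullet> w)"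
    using frechet_derivative_at[OF assms] by simp
  then show ?thesis by (simp add: grad_def partial_deriv_def vec_eq_iff inner_axis')
qed

lemma pos_def_imp_invertible:
  assumes "pos_def g"
  shows "invertible g"
proof -
  have "x = 0" if "g *v x = 0" for x
    using assms that unfolding pos_def_def by (metis inner_zero_right less_irrefl)
  then show ?thesis by (metis invertible_left_inverse matrix_left_invertible_ker)
qed

lemma matrix_inv_vector_cancel:
  fixes M :: "real^'n^'n::finite"
  assumes "invertible M"
  shows "matrix_inv M *v (M *v x) = x" "M *v (matrix_inv M *v x) = x"
proof -
  have "M ** matrix_inv M = mat 1 \<and> matrix_inv M ** M = mat 1"
    using assms unfolding invertible_def matrix_inv_def by (rule someI_ex)
  then show "matrix_inv M *v (M *v x) = x" "M *v (matrix_inv M *v x) = x"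
    by (simp_all add: matrix_vector_mul_assoc)
qed

lemma christoffel2_const: "christoffel2 (\<lambda>_. g) q k i j = 0"
  by (simp add: christoffel2_def christoffel1_def partial_deriv_def)

section \<open>Linear state feedback as a matching control law\<close>

theorem theorem2:
  fixes g P Vmat Cmat a b :: "real^'n^'n" and v :: "real^'n"
    and V :: "real^'n \<Rightarrow> real" and C u :: "real^'n \<Rightarrow> real^'n \<Rightarrow> real^'n"
  assumes "symmetric_mat g" and "pos_def g"
    and "orthogonal_projection g P"
    and "symmetric_mat Vmat"
    and "\<And>q. V q = (\<Sum>i\<in>UNIV. \<Sum>j\<in>UNIV. Vmat $ i $ j * q $ i * q $ j) + (\<Sum>k\<in>UNIV. v $ k * q $ k)"
    and "\<And>q qd. C q qd = Cmat *v qd"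
    and "\<And>q qd. u q qd = v + a *v q + b *v qd"
    and "respects_underactuation (\<lambda>_. g) (\<lambda>_. P) u"
  shows "\<exists>g' C' V'.
           admissible_closed_loop g' C' V' \<and>
           matching_conditions (\<lambda>_. g) (\<lambda>_. P) C V g' C' V' \<and>
           (\<forall>q qd. u q qd = matching_control (\<lambda>_. g) C V g' C' V' q qd)"
proof -
  let ?gi = "matrix_inv g"
  define A where "A = ?gi ** (2 *\<^sub>R Vmat - a)"
  obtain S where S: "symmetric_mat S" "invertible S" "symmetric_mat (S ** A)"
    using symmetric_symmetrizer by blast
  define C' where "C' = (\<lambda>(q::real^'n) (qd::real^'n). S *v (?gi *v ((Cmat - b) *v qd)))"
  define V' where "V' = (\<lambda>q. (q \<bullet> ((S ** A) *v q)) / 2)"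
  note g = pos_def_imp_invertible[OF \<open>pos_def g\<close>]

  have Vq: "V = (\<lambda>q. q \<bullet> (Vmat *v q) + q \<bullet> v)"
    by (rule ext) (simp add: assms(5) inner_vec_def matrix_vector_mult_def sum_distrib_left mult_ac)
  have "(V has_derivative (\<lambda>h. h \<bullet> (2 *\<^sub>R (Vmat *v q) + v))) (at q)" for q
    unfolding Vq
    using has_derivative_add[OF has_derivative_quadratic_form[OF assms(4)]
        has_derivative_inner_left[OF has_derivative_ident]]
    by (simp add: inner_add_right)
  then have gradV: "grad V q = 2 *\<^sub>R (Vmat *v q) + v" for q
    by (rule gradI)
  have "(V' has_derivative (\<lambda>h. h \<bullet> ((S ** A) *v q))) (at q)" for q
    unfolding V'_def using has_derivative_divide[OF has_derivative_quadratic_form[OF S(3)] has_derivative_const, of 2 q]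
    by simp
  then have "grad V' q = (S ** A) *v q" for q
    by (rule gradI)
  then have "matrix_inv S *v grad V' q = A *v q" for q
    by (simp add: matrix_inv_vector_cancel[OF S(2)] flip: matrix_vector_mul_assoc)
  then have pot: "?gi *v grad V q - matrix_inv S *v grad V' q = ?gi *v (v + a *v q)" for q
    by (simp add: gradV A_def matrix_vector_mult_add_rdistrib matrix_vector_mult_diff_rdistrib
        matrix_vector_mult_diff_distrib matrix_vector_right_distrib scaleR_matrix_vector_assoc
        flip: matrix_vector_mul_assoc)
  have diss: "?gi *v C q qd - matrix_inv S *v C' q qd = ?gi *v (b *v qd)" for q qd
    by (simp add: assms(6) C'_def matrix_inv_vector_cancel[OF S(2)] matrix_vector_mult_diff_rdistrib
        matrix_vector_mult_diff_distrib)

  text \<open>Setting the velocity, then the position, to zero separates the two parts of the condition on \<open>u\<close>.\<close>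
  have P0: "P *v (?gi *v (v + a *v q + b *v qd)) = 0" for q qd
    using assms(8) by (simp add: respects_underactuation_def assms(7))
  have Ppot: "P *v (?gi *v (v + a *v q)) = 0" for q
    using P0[of q 0] by simp
  then have Pdiss: "P *v (?gi *v (b *v qd)) = 0" for qd
    using P0[of 0 qd] Ppot[of 0] by (simp add: matrix_vector_right_distrib)

  have "admissible_closed_loop (\<lambda>_. S) C' V'"
  proof -
    have "linear (\<lambda>(q, qd). C' q qd $ i)" for i
      by (rule linearI)
        (auto simp: C'_def matrix_vector_right_distrib matrix_vector_mult_scaleR split: prod.splits)
    moreover have "C' q (- qd) = - C' q qd" for q qd
      unfolding C'_def by (metis vec.neg)
    ultimately show ?thesis
      using S smooth_quadratic_form[OF S(3)]
      by (simp add: admissible_closed_loop_def smooth_const smooth_linear V'_def)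
  qed
  moreover have "matching_conditions (\<lambda>_. g) (\<lambda>_. P) C V (\<lambda>_. S) C' V'"
    by (simp add: matching_conditions_def christoffel2_const pot diss Ppot Pdiss)
  moreover have "u q qd = matching_control (\<lambda>_. g) C V (\<lambda>_. S) C' V' q qd" for q qd
  proof -
    have "(\<chi> k. 0) = (0 :: real^'n)" by (simp add: vec_eq_iff)
    then show ?thesis
      by (simp add: matching_control_def christoffel2_const pot diss matrix_inv_vector_cancel[OF g]
          assms(7))
  qed
  ultimately show ?thesis by blast
qed

end
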